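(* $\mathsf{tJ}(\mathsf{C}_{\mathbb{N}})\equiv_{\mathrm W}\mathsf{T}(\mathsf{C}_{\mathbb{N}}\times\mathsf{W})$.
   Context: A problem is a partial multi-valued function $f:\subseteq\mathbb{N}^{\mathbb{N}}\rightrightarrows\mathbb{N}^{\mathbb{N}}$, with $\mathrm{dom}(f)=\{p: f(p)\ne\emptyset\}$. $f\le_{\mathrm W} g$ means there are partial computable functionals $\Phi:\subseteq\mathbb{N}^{\mathbb{N}}\to\mathbb{N}^{\mathbb{N}}$ and $\Psi:\subseteq\mathbb{N}^{\mathbb{N}}\times\mathbb{N}^{\mathbb{N}}\to\mathbb{N}^{\mathbb{N}}$ such that for every $p\in\mathrm{dom}(f)$: $\Phi(p)\in\mathrm{dom}(g)$ and $\Psi(p,q)\in f(p)$ for every $q\in g(\Phi(p))$. $f\equiv_{\mathrm W} g$ means $f\le_{\mathrm W} g$ and $g\le_{\mathrm W} f$. Finite products of copies of $\mathbb{N}$ and $\mathbb{N}^{\mathbb{N}}$ are identified with $\mathbb{N}^{\mathbb{N}}$ via standard computable codings; a natural number $n$ as an output is represented by any $p\in\mathbb{N}^{\mathbb{N}}$ with $p(0)=n$. $(\Phi_e)_{e\in\mathbb{N}}$ is a fixed standard computable enumeration of the partial computable functionals on $\mathbb{N}^{\mathbb{N}}$; $\Phi_i(p,q)$ means $\Phi_i$ applied to the pair $(p,q)$; $\downarrow$ means defined. Tot-jump: for $e,i\in\mathbb{N}$, $p\in\mathbb{N}^{\mathbb{N}}$, $\mathsf{tJ}(f)(e,i,p)=\{\Phi_i(p,q):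 q\in f(\Phi_e(p))\}$ if $\Phi_e(p)\in\mathrm{dom}(f)$ and $\Phi_i(p,q)\downarrow$ for all $q\in f(\Phi_e(p))$; otherwise $\mathsf{tJ}(f)(e,i,p)=\mathbb{N}^{\mathbb{N}}$. Totalization: $\mathsf{T}f(x)=f(x)$ if $x\in\mathrm{dom}(f)$ and $\mathsf{T}f(x)=\mathbb{N}^{\mathbb{N}}$ otherwise. Parallel product: $(f\times g)(x,y)=f(x)\times g(y)$, with domain $\mathrm{dom}(f)\times\mathrm{dom}(g)$. $\mathsf{C}_{\mathbb{N}}$: given $p\in\mathbb{N}^{\mathbb{N}}$ such that $(\exists n)\,n+1\notin\mathrm{ran}(p)$, find $n$ such that $n+1\notin\mathrm{ran}(p)$. $\mathsf{W}(p)=\{q\in\mathbb{N}^{\mathbb{N}}: (\forall i)\,q(i+1)>q(i)\text{ and }p\circ q=0^{\mathbb{N}}\}$, so that $\mathrm{dom}(\mathsf{W})$ is the set of $p$ with infinitely many zeroes. *)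

theory Defs
  imports Main "HOL-Library.Nat_Bijection"
begin

section \<open>Partial computable functionals on Baire space\<close>

type_synonym baire = "nat \<Rightarrow> nat"

text \<open>
  Partial recursive functions relative to an oracle, in unary form: a tuple of arguments is
  passed as one number through the Cantor pairing \<open>prod_encode\<close>, whose projections are
  basic functions. \<open>Query\<close> asks the oracle; \<open>PrimRec f g\<close> and \<open>Mu f\<close> are
  primitive recursion and (partial) minimization.
\<close>

datatype recf =
    Zero
  | Succ
  | Left
  | Right
  | Query
  | Tuple recf recf
  | Comp recf recf
  | PrimRec recf recf
  | Mu recf

primrec run :: "recf \<Rightarrow> baire \<Rightarrow> nat \<Rightarrow> nat option" where
  "run Zero p x = Some 0"
| "run Succ p x = Some (Suc x)"
| "run Left p x = Some (fst (prod_decode x))"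
| "run Right p x = Some (snd (prod_decode x))"
| "run Query p x = Some (p x)"
| "run (Tuple f g) p x =
     Option.bind (run f p x) (\<lambda>a. Option.bind (run g p x) (\<lambda>b. Some (prod_encode (a, b))))"
| "run (Comp f g) p x = Option.bind (run g p x) (run f p)"
| "run (PrimRec f g) p x =
     (case prod_decode x of (a, n) \<Rightarrow>
        rec_nat (run f p a)
          (\<lambda>k r. Option.bind r (\<lambda>y. run g p (prod_encode (a, prod_encode (k, y))))) n)"
| "run (Mu f) p x =
     (if \<exists>n. run f p (prod_encode (x, n)) = Some 0 \<and>
             (\<forall>m<n. \<exists>y. run f p (prod_encode (x, m)) = Some (Suc y))
      then Some (LEAST n. run f p (prod_encode (x, n)) = Some 0)
      else None)"

text \<open>A program computes a functional with values in Baire space: the value on \<open>p\<close> is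
  defined iff the program with oracle \<open>p\<close> halts on every input.\<close>

definition functional :: "recf \<Rightarrow> baire \<Rightarrow> baire option" where
  "functional t p =
     (if \<forall>n. run t p n \<noteq> None then Some (\<lambda>n. the (run t p n)) else None)"

definition partial_computable :: "(baire \<Rightarrow> baire option) \<Rightarrow> bool" where
  "partial_computable F \<longleftrightarrow> (\<exists>t. F = functional t)"

text \<open>Goedel numbering of the programs: an index is the code of a pair (tag, data).\<close>

function prog :: "nat \<Rightarrow> recf" where
  "prog e =
     (let (k, d) = prod_decode e; (a, b) = prod_decode d in
      if k = 0 then Zero
      else if k = 1 then Succ
      else if k = 2 then Left
      else if k = 3 then Right
      else if k = 4 then Query
      else if k = 5 then Tuple (prog a) (prog b)
      else if k = 6 then Comp (prog a) (prog b)
      else if k = 7 then PrimRec (prog a) (prog b)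
      else Mu (prog d))"
  by pat_completeness auto

lemma le_triangle: "n \<le> triangle n"
  by (induction n) auto

lemma prod_decode_less:
  assumes "prod_decode e = (k, d)" and "0 < k"
  shows "d < e"
proof -
  have e: "e = prod_encode (k, d)"
    using assms(1) by (metis prod_decode_inverse)
  have "k + d \<le> triangle (k + d)"
    using le_triangle by blast
  then show ?thesis
    using assms(2) unfolding e prod_encode_def by simp
qed

lemma prog_decreasing:
  assumes "(k, d) = prod_decode e" and "(a, b) = prod_decode d" and "0 < k"
  shows "a < e" and "b < e" and "d < e"
proof -
  show d: "d < e"
    using prod_decode_less[OF assms(1)[symmetric] assms(3)] .
  have "d = prod_encode (a, b)"
    using assms(2) by (metis prod_decode_inverse)
  then have "a \<le> d" "b \<le> d"
    using le_prod_encode_1 le_prod_encode_2 by auto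
  then show "a < e" "b < e"
    using d by auto
qed

termination prog
  by (relation "measure id") (auto intro: prog_decreasing)

declare prog.simps [simp del]

definition Phi :: "nat \<Rightarrow> baire \<Rightarrow> baire option" where
  "Phi e = functional (prog e)"

lemma surj_prog: "surj prog"
proof -
  have "\<exists>e. prog e = t" for t
  proof (induction t)
    case Zero
    show ?case by (rule exI[of _ "prod_encode (0, 0)"]) (simp add: prog.simps split: prod.split)
  next
    case Succ
    show ?case by (rule exI[of _ "prod_encode (1, 0)"]) (simp add: prog.simps split: prod.split)
  next
    case Left
    show ?case by (rule exI[of _ "prod_encode (2, 0)"]) (simp add: prog.simps split: prod.split)
  next
    case Right
    show ?case by (rule exI[of _ "prod_encode (3, 0)"]) (simp add: prog.simps split: prod.split)
  next
    case Query
    show ?case by (rule exI[of _ "prod_encode (4, 0)"]) (simp add: prog.simps split: prod.split)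
  next
    case (Tuple f g)
    then obtain a b where "prog a = f" "prog b = g" by blast
    then show ?case
      by (intro exI[of _ "prod_encode (5, prod_encode (a, b))"]) (subst prog.simps, simp)
  next
    case (Comp f g)
    then obtain a b where "prog a = f" "prog b = g" by blast
    then show ?case
      by (intro exI[of _ "prod_encode (6, prod_encode (a, b))"]) (subst prog.simps, simp)
  next
    case (PrimRec f g)
    then obtain a b where "prog a = f" "prog b = g" by blast
    then show ?case
      by (intro exI[of _ "prod_encode (7, prod_encode (a, b))"]) (subst prog.simps, simp)
  next
    case (Mu f)
    then obtain a where "prog a = f" by blast
    then show ?case
      by (intro exI[of _ "prod_encode (8, a)"]) (subst prog.simps, simp split: prod.split)
  qed
  then show ?thesis by (metis surjI)
qed

lemma partial_computable_iff_Phi: "partial_computable F \<longleftrightarrow> (\<exists>e. F = Phi e)"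
  unfolding partial_computable_def Phi_def using surj_prog by (metis surjD)


section \<open>Problems and Weihrauch reducibility\<close>

definition bpair :: "baire \<Rightarrow> baire \<Rightarrow> baire" where
  "bpair p q = (\<lambda>n. if even n then p (n div 2) else q (n div 2))"

definition bfst :: "baire \<Rightarrow> baire" where
  "bfst r = (\<lambda>n. r (2 * n))"

definition bsnd :: "baire \<Rightarrow> baire" where
  "bsnd r = (\<lambda>n. r (2 * n + 1))"

lemma bpair_simps [simp]:
  "bfst (bpair p q) = p" "bsnd (bpair p q) = q" "bpair (bfst r) (bsnd r) = r"
  by (auto simp: bpair_def bfst_def bsnd_def fun_eq_iff elim: oddE)

text \<open>A partial multi-valued function is a set-valued one that is empty off its domain.\<close>

type_synonym problem = "baire \<Rightarrow> baire set"

definition pdom :: "problem \<Rightarrow> baire set" where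
  "pdom f = {p. f p \<noteq> {}}"

definition weihrauch_le :: "problem \<Rightarrow> problem \<Rightarrow> bool" (infix "\<le>\<^sub>W" 50) where
  "f \<le>\<^sub>W g \<longleftrightarrow>
     (\<exists>F G. partial_computable F \<and> partial_computable G \<and>
        (\<forall>p\<in>pdom f. \<exists>x. F p = Some x \<and> x \<in> pdom g \<and>
           (\<forall>q\<in>g x. \<exists>y. G (bpair p q) = Some y \<and> y \<in> f p)))"

definition weihrauch_equiv :: "problem \<Rightarrow> problem \<Rightarrow> bool" (infix "\<equiv>\<^sub>W" 50) where
  "f \<equiv>\<^sub>W g \<longleftrightarrow> f \<le>\<^sub>W g \<and> g \<le>\<^sub>W f"

definition totalization :: "problem \<Rightarrow> problem" where
  "totalization f x = (if x \<in> pdom f then f x else UNIV)"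

definition parallel_product :: "problem \<Rightarrow> problem \<Rightarrow> problem" (infixr "\<times>\<^sub>p" 80) where
  "(f \<times>\<^sub>p g) r = {bpair u v | u v. u \<in> f (bfst r) \<and> v \<in> g (bsnd r)}"

definition tot_jump_at :: "problem \<Rightarrow> nat \<Rightarrow> nat \<Rightarrow> baire \<Rightarrow> baire set" where
  "tot_jump_at f e i p =
     (if \<exists>x. Phi e p = Some x \<and> x \<in> pdom f \<and> (\<forall>q\<in>f x. Phi i (bpair p q) \<noteq> None)
      then {the (Phi i (bpair p q)) | q. q \<in> f (the (Phi e p))}
      else UNIV)"

text \<open>The instance \<open>(e, i, p)\<close> is coded by the sequence \<open>e, i, p 0, p 1, \<dots>\<close>.\<close>

definition tot_jump :: "problem \<Rightarrow> problem" where
  "tot_jump f r = tot_jump_at f (r 0) (r 1) (\<lambda>n. r (n + 2))"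

text \<open>A natural number as a solution is represented by any sequence starting with it.\<close>

definition choice_nat :: problem ("C\<^sub>\<nat>") where
  "choice_nat p = {q. q 0 + 1 \<notin> range p}"

definition W :: problem where
  "W p = {q. (\<forall>i. q (i + 1) > q i) \<and> p \<circ> q = (\<lambda>_. 0)}"

end

theory Submission
  imports Defs
begin

text \<open>
  The totalized problem reduces to the jump directly. Given \<open>(u, v)\<close>, ask the jump for the
  composition of \<open>C\<^sub>\<nat>\<close> with the two functionals that send \<open>(u, v)\<close> to
  \<open>u\<close> and send \<open>((u, v), q)\<close> to \<open>q\<close> paired with the increasing
  enumeration of the zeros of \<open>v\<close>. If \<open>(u, v)\<close> has a solution, then both
  functionals are defined where the jump needs them, and its answer is a solution; otherwise every
  sequence is accepted (\<open>parallel_choice_le_tot_jump\<close>).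

  The converse (\<open>tot_jump_le_parallel_choice\<close>) has to send every instance
  \<open>(e, i, p)\<close>, meaningful or not, to a pair of sequences, and to turn every answer to that
  pair into a sequence. So all simulations must be cut off after finitely many steps: unbounded
  search is delegated to \<open>W\<close>, and an answer of \<open>W\<close> serves as a sequence of time
  bounds. Call the instance meaningful if the first case in the definition of the jump applies, with
  \<open>x\<close> the value of \<open>\<Phi>\<^sub>e\<close> at \<open>p\<close>.

  \<^item> The query \<open>u\<close> to \<open>C\<^sub>\<nat>\<close> lists, over all pairs \<open>(m, t)\<close>, the
  value \<open>x m\<close> if it is computed within \<open>t\<close> steps, and \<open>0\<close> otherwise.
  Since \<open>C\<^sub>\<nat>\<close> ignores the value \<open>0\<close>, this has the same solutions as
  \<open>x\<close> in the meaningful case.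

  \<^item> The query \<open>v\<close> to \<open>W\<close> cannot know which \<open>n\<close> will be chosen, so it
  waits for all of them. Its \<open>k\<close>-th zero, counted from \<open>0\<close>, is the first stage after the earlier zeros
  by which each \<open>n \<le> k\<close> is either listed by \<open>u\<close> (\<open>n + 1\<close> has occurred)
  or has the digits \<open>0, \<dots>, k\<close> of \<open>\<Phi>\<^sub>i(p, n)\<close> computed. In the meaningful case
  each of these waits ends, so \<open>v\<close> has infinitely many zeros.

  \<^item> If \<open>n\<close> and \<open>w\<close> solve the two queries, then \<open>w (max k n)\<close> is a zero of
  \<open>v\<close> preceded by at least \<open>max k n\<close> zeros. As \<open>n\<close> is never listed, digit
  \<open>k\<close> of \<open>\<Phi>\<^sub>i(p, n)\<close> is computed within \<open>w (max k n)\<close> steps. Run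
  the computation that long, and output \<open>0\<close> if it has not halted by then: this is defined for
  arbitrary \<open>n\<close> and \<open>w\<close>.

  Computability of these queries rests on a universal machine with a step bound. It is an abstract
  machine with an explicit stack, whose states are numbers and whose single step is an operation without
  recursion; iterating it is one primitive recursion.
\<close>

section \<open>Total operations computable from an oracle\<close>

abbreviation cpair :: "nat \<Rightarrow> nat \<Rightarrow> nat" ("\<langle>_,/ _\<rangle>") where
  "\<langle>a, b\<rangle> \<equiv> prod_encode (a, b)"

abbreviation pfst :: "nat \<Rightarrow> nat" where
  "pfst n \<equiv> fst (prod_decode n)"

abbreviation psnd :: "nat \<Rightarrow> nat" where
  "psnd n \<equiv> snd (prod_decode n)"

text \<open>The second argument also serves as an environment: several variables are passed as one
  number, and binders extend it by pairing. The closure rules below follow the syntax of terms, so that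
  \<open>intro total_rec_intros\<close> proves computability of an explicitly written operation.\<close>

definition total_rec :: "(baire \<Rightarrow> nat \<Rightarrow> nat) \<Rightarrow> bool" where
  "total_rec f \<longleftrightarrow> (\<exists>t. \<forall>p x. run t p x = Some (f p x))"

definition decidable :: "(baire \<Rightarrow> nat \<Rightarrow> bool) \<Rightarrow> bool" where
  "decidable P \<longleftrightarrow> total_rec (\<lambda>p x. if P p x then 1 else 0)"

lemma total_recI: "(\<And>p x. run t p x = Some (f p x)) \<Longrightarrow> total_rec f"
  unfolding total_rec_def by blast

lemma total_recE:
  assumes "total_rec f"
  obtains t where "\<And>p x. run t p x = Some (f p x)"
  using assms unfolding total_rec_def by blast

named_theorems total_rec_intros

lemma total_rec_id [total_rec_intros]: "total_rec (\<lambda>p x. x)"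
  by (rule total_recI[of "Tuple Left Right"]) simp

lemma total_rec_comp:
  assumes "total_rec f" and "total_rec g"
  shows "total_rec (\<lambda>p x. f p (g p x))"
proof -
  obtain s t where "\<And>p x. run s p x = Some (f p x)" "\<And>p x. run t p x = Some (g p x)"
    using assms by (metis total_recE)
  then show ?thesis by (intro total_recI[of "Comp s t"]) simp
qed

lemma total_rec_cpair [total_rec_intros]:
  assumes "total_rec f" and "total_rec g"
  shows "total_rec (\<lambda>p x. \<langle>f p x, g p x\<rangle>)"
proof -
  obtain s t where "\<And>p x. run s p x = Some (f p x)" "\<And>p x. run t p x = Some (g p x)"
    using assms by (metis total_recE)
  then show ?thesis by (intro total_recI[of "Tuple s t"]) simp
qed

lemma total_rec_Suc [total_rec_intros]: "total_rec f \<Longrightarrow> total_rec (\<lambda>p x. Suc (f p x))"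
  by (rule total_rec_comp, rule total_recI[of Succ]) simp

lemma total_rec_pfst [total_rec_intros]: "total_rec f \<Longrightarrow> total_rec (\<lambda>p x. pfst (f p x))"
  by (rule total_rec_comp, rule total_recI[of Left]) simp

lemma total_rec_psnd [total_rec_intros]: "total_rec f \<Longrightarrow> total_rec (\<lambda>p x. psnd (f p x))"
  by (rule total_rec_comp, rule total_recI[of Right]) simp

lemma total_rec_query [total_rec_intros]: "total_rec f \<Longrightarrow> total_rec (\<lambda>p x. p (f p x))"
  by (rule total_rec_comp, rule total_recI[of Query]) simp

lemma total_rec_const [total_rec_intros]: "total_rec (\<lambda>p x. c)"
proof (induction c)
  case 0
  show ?case by (rule total_recI[of Zero]) simp
next
  case (Suc c)
  then show ?case by (rule total_rec_Suc)
qed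

text \<open>Composition for operations of two numerical arguments; it transfers the computability of a
  body under a binder to its instances.\<close>

lemma total_rec_comp2:
  assumes "total_rec (\<lambda>p z. f p (pfst z) (psnd z))" and "total_rec g" and "total_rec h"
  shows "total_rec (\<lambda>p x. f p (g p x) (h p x))"
  using total_rec_comp[OF assms(1) total_rec_cpair[OF assms(2,3)]] by simp

text \<open>The parameter \<open>x\<close> is kept in the first component while the recursion runs, so
  the step sees \<open>(x, (k, y))\<close>, with \<open>k\<close> the stage and \<open>y\<close> the previous
  value.\<close>

lemma total_rec_rec_nat [total_rec_intros]:
  assumes "total_rec f"
    and "total_rec (\<lambda>p z. g p (pfst z) (pfst (psnd z)) (psnd (psnd z)))"
    and "total_rec n"
  shows "total_rec (\<lambda>p x. rec_nat (f p x) (\<lambda>k y. g p x k y) (n p x))"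
proof -
  obtain tf where tf: "\<And>p x. run tf p x = Some (f p x)"
    using assms(1) by (rule total_recE) blast
  obtain tg where tg: "\<And>p z. run tg p z = Some (g p (pfst z) (pfst (psnd z)) (psnd (psnd z)))"
    using assms(2) by (rule total_recE) blast
  have "run (PrimRec tf tg) p \<langle>a, m\<rangle> = Some (rec_nat (f p a) (\<lambda>k y. g p a k y) m)" for p a m
    by (induction m) (simp_all add: tf tg)
  then have "total_rec (\<lambda>p z. rec_nat (f p (pfst z)) (\<lambda>k y. g p (pfst z) k y) (psnd z))"
    by (intro total_recI[of "PrimRec tf tg"]) (metis prod.collapse prod_decode_inverse)
  from total_rec_comp2[OF this total_rec_id assms(3)] show ?thesis .
qed

lemma total_rec_add [total_rec_intros]:
  assumes "total_rec f" and "total_rec g"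
  shows "total_rec (\<lambda>p x. f p x + g p x)"
proof -
  have "a + b = rec_nat a (\<lambda>k y. Suc y) b" for a b
    by (induction b) auto
  then show ?thesis
    using assms by (simp only:) (intro total_rec_intros)
qed

lemma total_rec_mult [total_rec_intros]:
  assumes "total_rec f" and "total_rec g"
  shows "total_rec (\<lambda>p x. f p x * g p x)"
proof -
  have "a * b = rec_nat 0 (\<lambda>k y. y + a) b" for a b :: nat
    by (induction b) auto
  then show ?thesis
    using assms by (simp only:) (intro total_rec_intros total_rec_comp[OF assms(1)])
qed

lemma total_rec_diff [total_rec_intros]:
  assumes "total_rec f" and "total_rec g"
  shows "total_rec (\<lambda>p x. f p x - g p x)"
proof -
  \<comment> \<open>The predecessor is the last stage that a recursion passes through.\<close>
  have pred: "y - 1 = rec_nat 0 (\<lambda>k z. k) y" for y :: nat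
    by (cases y) auto
  have "a - b = rec_nat a (\<lambda>k y. y - 1) b" for a b :: nat
    by (induction b) auto
  then have "a - b = rec_nat a (\<lambda>k y. rec_nat 0 (\<lambda>k z. k) y) b" for a b :: nat
    unfolding pred .
  then show ?thesis
    using assms by (simp only:) (intro total_rec_intros)
qed

text \<open>Both branches may be evaluated since everything is total, so a case distinction is a
  recursion of length one or zero that forgets the previous value.\<close>

lemma total_rec_if [total_rec_intros]:
  assumes "decidable P" and "total_rec f" and "total_rec g"
  shows "total_rec (\<lambda>p x. if P p x then f p x else g p x)"
proof -
  have eq: "(\<lambda>p x. if P p x then f p x else g p x) =
      (\<lambda>p x. rec_nat (g p x) (\<lambda>k y. f p x) (if P p x then 1 else 0))"
    by (auto simp: fun_eq_iff)
  show ?thesis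
    unfolding eq using assms(1)[unfolded decidable_def] assms(3)
    by (intro total_rec_rec_nat total_rec_comp[OF assms(2)] total_rec_intros)
qed

lemma decidable_less [total_rec_intros]:
  assumes "total_rec f" and "total_rec g"
  shows "decidable (\<lambda>p x. f p x < g p x)"
proof -
  have "(if a < b then 1 else 0) = 1 - (1 - (b - a))" for a b :: nat
    by simp
  then show ?thesis
    using assms unfolding decidable_def by (simp only:) (intro total_rec_intros)
qed

lemma decidable_not [total_rec_intros]:
  assumes "decidable P"
  shows "decidable (\<lambda>p x. \<not> P p x)"
proof -
  have "(if \<not> P p x then 1 else 0) = (if P p x then 0 else 1 :: nat)" for p x
    by simp
  then show ?thesis
    using assms unfolding decidable_def[of "\<lambda>p x. \<not> P p x"]
    by (simp only:) (intro total_rec_intros)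
qed

lemma decidable_conj [total_rec_intros]:
  assumes "decidable P" and "decidable Q"
  shows "decidable (\<lambda>p x. P p x \<and> Q p x)"
proof -
  have "(if P p x \<and> Q p x then 1 else 0) = (if P p x then if Q p x then 1 else 0 else 0 :: nat)" for p x
    by simp
  then show ?thesis
    using assms unfolding decidable_def[of "\<lambda>p x. P p x \<and> Q p x"]
    by (simp only:) (intro total_rec_intros)
qed

lemma decidable_disj [total_rec_intros]:
  assumes "decidable P" and "decidable Q"
  shows "decidable (\<lambda>p x. P p x \<or> Q p x)"
proof -
  have "decidable (\<lambda>p x. \<not> (\<not> P p x \<and> \<not> Q p x))"
    using assms by (intro total_rec_intros)
  then show ?thesis by simp
qed

lemma decidable_le [total_rec_intros]:
  assumes "total_rec f" and "total_rec g"
  shows "decidable (\<lambda>p x. f p x \<le> g p x)"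
  unfolding not_less[symmetric] using assms by (intro total_rec_intros)

lemma decidable_eq [total_rec_intros]:
  fixes f g :: "baire \<Rightarrow> nat \<Rightarrow> nat"
  assumes "total_rec f" and "total_rec g"
  shows "decidable (\<lambda>p x. f p x = g p x)"
proof -
  have "decidable (\<lambda>p x. f p x \<le> g p x \<and> g p x \<le> f p x)"
    using assms by (intro total_rec_intros)
  moreover have "(\<lambda>p x. f p x = g p x) = (\<lambda>p x. f p x \<le> g p x \<and> g p x \<le> f p x)"
    by (auto simp: fun_eq_iff)
  ultimately show ?thesis by simp
qed

lemma decidable_ball [total_rec_intros]:
  assumes "decidable (\<lambda>p z. P p (pfst z) (psnd z))" and "total_rec b"
  shows "decidable (\<lambda>p x. \<forall>k\<le>b p x. P p x k)"
proof -
  have rec: "(if \<forall>k<m. P p x k then 1 else 0) =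
      rec_nat (1 :: nat) (\<lambda>k y. if P p x k then y else 0) m" for p x m
    by (induction m) (simp_all add: less_Suc_eq all_conj_distrib imp_conjL)
  have eq: "(\<lambda>p x. if \<forall>k\<le>b p x. P p x k then 1 else 0) =
      (\<lambda>p x. rec_nat (1 :: nat) (\<lambda>k y. if P p x k then y else 0) (Suc (b p x)))"
    by (simp only: rec[symmetric] less_Suc_eq_le)
  have "decidable (\<lambda>p z. P p (pfst z) (pfst (psnd z)))"
    using assms(1) unfolding decidable_def
    by (rule total_rec_comp2[where f = "\<lambda>p a b. if P p a b then 1 else 0"])
      (intro total_rec_intros)+
  then show ?thesis
    unfolding decidable_def[of "\<lambda>p x. \<forall>k\<le>b p x. P p x k"] eq
    by (intro total_rec_intros assms(2))
qed

lemma decidable_bex [total_rec_intros]: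
  assumes "decidable (\<lambda>p z. P p (pfst z) (psnd z))" and "total_rec b"
  shows "decidable (\<lambda>p x. \<exists>k\<le>b p x. P p x k)"
proof -
  have "decidable (\<lambda>p x. \<not> (\<forall>k\<le>b p x. \<not> P p x k))"
    using assms by (intro total_rec_intros)
  then show ?thesis by simp
qed

lemma total_rec_max [total_rec_intros]:
  fixes f g :: "baire \<Rightarrow> nat \<Rightarrow> nat"
  assumes "total_rec f" and "total_rec g"
  shows "total_rec (\<lambda>p x. max (f p x) (g p x))"
  unfolding max_def using assms by (intro total_rec_intros)

lemma total_rec_half [total_rec_intros]:
  assumes "total_rec f"
  shows "total_rec (\<lambda>p x. f p x div 2)"
proof -
  have "m div 2 = rec_nat 0 (\<lambda>k y. if k < 2 * y + 1 then y else Suc y) m" for m :: nat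
    by (induction m) auto
  then show ?thesis
    using assms by (simp only:) (intro total_rec_intros)
qed

lemma decidable_even [total_rec_intros]:
  assumes "total_rec f"
  shows "decidable (\<lambda>p x. even (f p x))"
proof -
  have "even m \<longleftrightarrow> 2 * (m div 2) = m" for m :: nat
    by presburger
  then show ?thesis
    using assms by (simp only:) (intro total_rec_intros)
qed

lemma total_rec_funpow [total_rec_intros]:
  assumes "total_rec (\<lambda>p z. f p (pfst z) (psnd z))" and "total_rec n" and "total_rec a"
  shows "total_rec (\<lambda>p x. (f p x ^^ n p x) (a p x))"
proof -
  have "(h ^^ m) c = rec_nat c (\<lambda>k y. h y) m" for h m and c :: nat
    by (induction m) auto
  then show ?thesis
    using assms
    by (simp only:) (intro total_rec_intros total_rec_comp2[OF assms(1)])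
qed

lemma partial_computable_total:
  assumes "total_rec f"
  shows "partial_computable (\<lambda>p. Some (f p))"
proof -
  obtain t where "\<And>p x. run t p x = Some (f p x)"
    using assms by (rule total_recE) blast
  then have "functional t = (\<lambda>p. Some (f p))"
    by (auto simp: functional_def)
  then show ?thesis
    unfolding partial_computable_def by metis
qed

text \<open>The only source of partiality that is needed: one unbounded search in front of a decidable
  condition.\<close>

lemma partial_computable_search:
  assumes "decidable (\<lambda>p z. P p (pfst z) (psnd z))"
  shows "partial_computable
    (\<lambda>p. if \<forall>n. \<exists>y. P p n y then Some (\<lambda>n. LEAST y. P p n y) else None)"
proof -
  have "total_rec (\<lambda>p z. if P p (pfst z) (psnd z) then 0 else 1)"
    using assms by (intro total_rec_intros)
  then obtain t where t: "\<And>p x. run t p x = Some (if P p (pfst x) (psnd x) then 0 else 1)"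
    by (rule total_recE) blast
  have zero: "run t p \<langle>n, m\<rangle> = Some 0 \<longleftrightarrow> P p n m" for p n m
    by (simp add: t)
  have pos: "(\<exists>y. run t p \<langle>n, m\<rangle> = Some (Suc y)) \<longleftrightarrow> \<not> P p n m" for p n m
    by (simp add: t)
  have ex: "(\<exists>y. P p n y \<and> (\<forall>m<y. \<not> P p n m)) \<longleftrightarrow> (\<exists>y. P p n y)" for p n
    using exists_least_iff[of "P p n"] by blast
  have "run (Mu t) p n = (if \<exists>y. P p n y then Some (LEAST y. P p n y) else None)" for p n
    by (simp only: run.simps zero pos ex)
  then have "functional (Mu t) =
      (\<lambda>p. if \<forall>n. \<exists>y. P p n y then Some (\<lambda>n. LEAST y. P p n y) else None)"
    by (auto simp: functional_def fun_eq_iff simp del: run.simps)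
  then show ?thesis
    unfolding partial_computable_def by metis
qed


section \<open>A step-bounded universal machine\<close>

text \<open>
  States of the machine are codes of triples. \<open>eval_state e x K\<close> asks for the value of the
  program with index \<open>e\<close> at \<open>x\<close>, and \<open>return_state y K\<close> delivers the value
  \<open>y\<close>, both to the stack \<open>K\<close> of pending frames. The successor in
  \<open>eval_state\<close> keeps the two kinds of states apart. A frame is a tag, data and the rest of the
  stack; tag \<open>0\<close> is reserved for the empty stack, which is the number
  \<open>0 = \<langle>0, 0\<rangle>\<close>.
\<close>

definition eval_state :: "nat \<Rightarrow> nat \<Rightarrow> nat \<Rightarrow> nat" where
  "eval_state e x K = \<langle>Suc e, \<langle>x, K\<rangle>\<rangle>"

definition return_state :: "nat \<Rightarrow> nat \<Rightarrow> nat" where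
  "return_state y K = \<langle>0, \<langle>y, K\<rangle>\<rangle>"

definition frame :: "nat \<Rightarrow> nat \<Rightarrow> nat \<Rightarrow> nat" where
  "frame t d K = \<langle>t, \<langle>d, K\<rangle>\<rangle>"

definition start :: "baire \<Rightarrow> nat \<Rightarrow> nat \<Rightarrow> nat \<Rightarrow> nat" where
  "start p e x K =
     (let t = pfst e; d = psnd e; a = pfst d; b = psnd d in
      if t = 0 then return_state 0 K
      else if t = 1 then return_state (Suc x) K
      else if t = 2 then return_state (pfst x) K
      else if t = 3 then return_state (psnd x) K
      else if t = 4 then return_state (p x) K
      else if t = 5 then eval_state a x (frame 1 \<langle>b, x\<rangle> K)
      else if t = 6 then eval_state b x (frame 3 a K)
      else if t = 7 then eval_state a (pfst x) (frame 4 \<langle>b, \<langle>pfst x, \<langle>0, psnd x\<rangle>\<rangle>\<rangle> K)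
      else eval_state d \<langle>x, 0\<rangle> (frame 5 \<langle>d, \<langle>x, 0\<rangle>\<rangle> K))"

text \<open>
  The tags stand for a computation that waits for: the first component of a tuple (1), its second
  component (2), the inner function of a composition (3), the value at stage \<open>k\<close> of a
  primitive recursion of length \<open>n\<close> (4, with data \<open>\<langle>g, \<langle>a, \<langle>k, n\<rangle>\<rangle>\<rangle>\<close>), the value
  at the current candidate \<open>n\<close> of a minimization (5, with data
  \<open>\<langle>f, \<langle>x, n\<rangle>\<rangle>\<close>).
\<close>

definition resume :: "nat \<Rightarrow> nat \<Rightarrow> nat" where
  "resume y K =
     (let t = pfst K; d = pfst (psnd K); K' = psnd (psnd K);
          c = pfst d; x = pfst (psnd d); n = psnd (psnd d) in
      if t = 0 then return_state y K
      else if t = 1 then eval_state c (psnd d) (frame 2 y K')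
      else if t = 2 then return_state \<langle>d, y\<rangle> K'
      else if t = 3 then eval_state d y K'
      else if t = 4 then
        (if pfst n = psnd n then return_state y K'
         else eval_state c \<langle>x, \<langle>pfst n, y\<rangle>\<rangle> (frame 4 \<langle>c, \<langle>x, \<langle>Suc (pfst n), psnd n\<rangle>\<rangle>\<rangle> K'))
      else if y = 0 then return_state n K'
      else eval_state c \<langle>x, Suc n\<rangle> (frame 5 \<langle>c, \<langle>x, Suc n\<rangle>\<rangle> K'))"

definition step :: "baire \<Rightarrow> nat \<Rightarrow> nat" where
  "step p st =
     (if pfst st = 0 then resume (pfst (psnd st)) (psnd (psnd st))
      else start p (pfst st - 1) (pfst (psnd st)) (psnd (psnd st)))"

text \<open>The value \<open>0\<close> means that the machine has not halted within \<open>s\<close> steps, and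
  \<open>Suc y\<close> that it has halted with result \<open>y\<close>.\<close>

definition bounded_run :: "baire \<Rightarrow> nat \<Rightarrow> nat \<Rightarrow> nat \<Rightarrow> nat" where
  "bounded_run p e x s =
     (let st = (step p ^^ s) (eval_state e x 0) in
      if pfst st = 0 \<and> psnd (psnd st) = 0 then Suc (pfst (psnd st)) else 0)"

lemma step_eval [simp]: "step p (eval_state e x K) = start p e x K"
  by (simp add: step_def eval_state_def)

lemma step_return [simp]: "step p (return_state y K) = resume y K"
  by (simp add: step_def return_state_def)

definition reaches :: "baire \<Rightarrow> nat \<Rightarrow> nat \<Rightarrow> bool" where
  "reaches p st st' \<longleftrightarrow> (\<exists>s. (step p ^^ s) st = st')"

lemma reaches_refl: "reaches p st st"
  unfolding reaches_def by (rule exI[of _ 0]) simp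

lemma reaches_trans [trans]:
  assumes "reaches p a b" and "reaches p b c"
  shows "reaches p a c"
proof -
  obtain s s' where "(step p ^^ s) a = b" "(step p ^^ s') b = c"
    using assms unfolding reaches_def by blast
  then have "(step p ^^ (s' + s)) a = c"
    by (simp add: funpow_add)
  then show ?thesis
    unfolding reaches_def by blast
qed

lemma reaches_step: "step p a = b \<Longrightarrow> reaches p a b"
  unfolding reaches_def by (rule exI[of _ 1]) simp

text \<open>The stack \<open>K\<close> is arbitrary, since the subprograms run on top of the frames that
  their callers have pushed. The two loops need an inner induction: on the stage for primitive recursion,
  where frame \<open>k\<close> is met with the value at stage \<open>k\<close>, and on the candidate for
  minimization.\<close>

lemma run_reaches:
  "run (prog e) p x = Some y \<Longrightarrow> reaches p (eval_state e x K) (return_state y K)"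
proof (induction e arbitrary: x y K rule: less_induct)
  case (less e)
  define t d a b where "t = pfst e" and "d = psnd e" and "a = pfst d" and "b = psnd d"
  note defs = this
  have pe: "(t, d) = prod_decode e" and pd: "(a, b) = prod_decode d"
    by (simp_all add: defs)
  have prog: "prog e =
     (if t = 0 then Zero
      else if t = 1 then Succ
      else if t = 2 then Left
      else if t = 3 then Right
      else if t = 4 then Query
      else if t = 5 then Tuple (prog a) (prog b)
      else if t = 6 then Comp (prog a) (prog b)
      else if t = 7 then PrimRec (prog a) (prog b)
      else Mu (prog d))"
    by (subst prog.simps) (simp add: pe[symmetric] pd[symmetric])
  have start: "start p e x K =
     (if t = 0 then return_state 0 K
      else if t = 1 then return_state (Suc x) K
      else if t = 2 then return_state (pfst x) K
      else if t = 3 then return_state (psnd x) K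
      else if t = 4 then return_state (p x) K
      else if t = 5 then eval_state a x (frame 1 \<langle>b, x\<rangle> K)
      else if t = 6 then eval_state b x (frame 3 a K)
      else if t = 7 then eval_state a (pfst x) (frame 4 \<langle>b, \<langle>pfst x, \<langle>0, psnd x\<rangle>\<rangle>\<rangle> K)
      else eval_state d \<langle>x, 0\<rangle> (frame 5 \<langle>d, \<langle>x, 0\<rangle>\<rangle> K))" for x K
    unfolding start_def Let_def defs ..
  have IHa: "reaches p (eval_state a x K) (return_state y K)"
    if "0 < t" "run (prog a) p x = Some y" for x y K
    using less.IH prog_decreasing(1)[OF pe pd] that by blast
  have IHb: "reaches p (eval_state b x K) (return_state y K)"
    if "0 < t" "run (prog b) p x = Some y" for x y K
    using less.IH prog_decreasing(2)[OF pe pd] that by blast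
  have IHd: "reaches p (eval_state d x K) (return_state y K)"
    if "0 < t" "run (prog d) p x = Some y" for x y K
    using less.IH prog_decreasing(3)[OF pe pd] that by blast
  have entry: "reaches p (eval_state e x K) (start p e x K)"
    by (rule reaches_step) simp
  consider "t < 5" | "t = 5" | "t = 6" | "t = 7" | "7 < t"
    by linarith
  then show ?case
  proof cases
    case 1
    then have "start p e x K = return_state y K"
      using less.prems unfolding prog start by (auto split: if_splits)
    then show ?thesis
      using entry by simp
  next
    case 2
    then obtain u v where u: "run (prog a) p x = Some u" and v: "run (prog b) p x = Some v"
      and y: "y = \<langle>u, v\<rangle>"
      using less.prems unfolding prog by (auto simp: bind_eq_Some_conv)
    note entry
    also have "start p e x K = eval_state a x (frame 1 \<langle>b, x\<rangle> K)"
      using 2 by (simp add: start)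
    also have "reaches p \<dots> (return_state u (frame 1 \<langle>b, x\<rangle> K))"
      using IHa u 2 by simp
    also have "reaches p \<dots> (eval_state b x (frame 2 u K))"
      by (rule reaches_step) (simp add: resume_def frame_def)
    also have "reaches p \<dots> (return_state v (frame 2 u K))"
      using IHb v 2 by simp
    also have "reaches p \<dots> (return_state y K)"
      by (rule reaches_step) (simp add: resume_def frame_def y)
    finally show ?thesis .
  next
    case 3
    then obtain u where u: "run (prog b) p x = Some u" and y: "run (prog a) p u = Some y"
      using less.prems unfolding prog by (auto simp: bind_eq_Some_conv)
    note entry
    also have "start p e x K = eval_state b x (frame 3 a K)"
      using 3 by (simp add: start)
    also have "reaches p \<dots> (return_state u (frame 3 a K))"
      using IHb u 3 by simp
    also have "reaches p \<dots> (eval_state a u K)"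
      by (rule reaches_step) (simp add: resume_def frame_def)
    also have "reaches p \<dots> (return_state y K)"
      using IHa y 3 by simp
    finally show ?thesis .
  next
    case 4
    define c n where "c = pfst x" and "n = psnd x"
    let ?r = "rec_nat (run (prog a) p c)
      (\<lambda>k r. Option.bind r (\<lambda>y. run (prog b) p \<langle>c, \<langle>k, y\<rangle>\<rangle>))"
    let ?F = "\<lambda>k. frame 4 \<langle>b, \<langle>c, \<langle>k, n\<rangle>\<rangle>\<rangle> K"
    have loop: "reaches p (eval_state a c (?F 0)) (return_state z (?F k))"
      if "?r k = Some z" "k \<le> n" for k z
      using that
    proof (induction k arbitrary: z)
      case 0
      then show ?case using IHa 4 by simp
    next
      case (Suc k)
      then obtain w where w: "?r k = Some w" and z: "run (prog b) p \<langle>c, \<langle>k, w\<rangle>\<rangle> = Some z"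
        by (auto simp: bind_eq_Some_conv)
      have "reaches p (eval_state a c (?F 0)) (return_state w (?F k))"
        using Suc w by simp
      also have "reaches p \<dots> (eval_state b \<langle>c, \<langle>k, w\<rangle>\<rangle> (?F (Suc k)))"
        by (rule reaches_step) (use Suc.prems in \<open>simp add: resume_def frame_def\<close>)
      also have "reaches p \<dots> (return_state z (?F (Suc k)))"
        using IHb z 4 by simp
      finally show ?case .
    qed
    have r: "?r n = Some y"
      using less.prems 4 unfolding prog by (simp add: c_def n_def split: prod.splits)
    note entry
    also have "start p e x K = eval_state a c (?F 0)"
      using 4 by (simp add: start c_def n_def)
    also have "reaches p \<dots> (return_state y (?F n))"
      using loop r by simp
    also have "reaches p \<dots> (return_state y K)"
      by (rule reaches_step) (simp add: resume_def frame_def)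
    finally show ?thesis .
  next
    case 5
    let ?F = "\<lambda>k. frame 5 \<langle>d, \<langle>x, k\<rangle>\<rangle> K"
    have run: "run (Mu (prog d)) p x = Some y"
      using less.prems 5 unfolding prog by (simp del: run.simps)
    then obtain n where n: "run (prog d) p \<langle>x, n\<rangle> = Some 0"
      and below: "\<And>m. m < n \<Longrightarrow> \<exists>z. run (prog d) p \<langle>x, m\<rangle> = Some (Suc z)"
      by (auto split: if_splits)
    have "y = (LEAST n. run (prog d) p \<langle>x, n\<rangle> = Some 0)"
      using run by (auto split: if_splits)
    also have "\<dots> = n"
      using n below by (intro Least_equality) (metis leI nat.distinct(1) option.inject)+
    finally have y: "y = n" .
    have loop: "reaches p (eval_state d \<langle>x, 0\<rangle> (?F 0)) (eval_state d \<langle>x, k\<rangle> (?F k))"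
      if "k \<le> n" for k
      using that
    proof (induction k)
      case 0
      show ?case by (rule reaches_refl)
    next
      case (Suc k)
      then obtain z where z: "run (prog d) p \<langle>x, k\<rangle> = Some (Suc z)"
        using below[of k] by auto
      have "reaches p (eval_state d \<langle>x, 0\<rangle> (?F 0)) (eval_state d \<langle>x, k\<rangle> (?F k))"
        using Suc by simp
      also have "reaches p \<dots> (return_state (Suc z) (?F k))"
        using IHd z 5 by simp
      also have "reaches p \<dots> (eval_state d \<langle>x, Suc k\<rangle> (?F (Suc k)))"
        by (rule reaches_step) (simp add: resume_def frame_def)
      finally show ?case .
    qed
    note entry
    also have "start p e x K = eval_state d \<langle>x, 0\<rangle> (?F 0)"
      using 5 by (simp add: start)
    also have "reaches p \<dots> (eval_state d \<langle>x, n\<rangle> (?F n))"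
      using loop by simp
    also have "reaches p \<dots> (return_state 0 (?F n))"
      using IHd n 5 by simp
    also have "reaches p \<dots> (return_state y K)"
      by (rule reaches_step) (simp add: resume_def frame_def y)
    finally show ?thesis .
  qed
qed

lemma bounded_run_eq_Suc:
  "bounded_run p e x s = Suc y \<longleftrightarrow> (step p ^^ s) (eval_state e x 0) = return_state y 0"
proof -
  have "st = return_state y 0 \<longleftrightarrow> pfst st = 0 \<and> psnd (psnd st) = 0 \<and> pfst (psnd st) = y" for st
    unfolding return_state_def
    by (metis fst_conv snd_conv prod.collapse prod_decode_inverse prod_encode_inverse)
  then show ?thesis
    by (auto simp: bounded_run_def Let_def)
qed

text \<open>A value on the empty stack is a fixed point of the step, so results persist when the step
  bound grows.\<close>

lemma halted_stable: "(step p ^^ s) (return_state y 0) = return_state y 0"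
proof (induction s)
  case (Suc s)
  have "pfst 0 = 0"
    by (simp add: prod_decode_def prod_decode_aux.simps)
  then show ?case
    using Suc by (simp add: resume_def)
qed simp

lemma bounded_run_mono:
  assumes "bounded_run p e x s = Suc y" and "s \<le> s'"
  shows "bounded_run p e x s' = Suc y"
proof -
  have "(step p ^^ (s' - s + s)) (eval_state e x 0) = return_state y 0"
    using assms(1) by (simp only: funpow_add o_apply bounded_run_eq_Suc halted_stable)
  then show ?thesis
    using assms(2) by (simp add: bounded_run_eq_Suc)
qed

lemma bounded_run_halts:
  assumes "run (prog e) p x = Some y"
  shows "\<exists>s. bounded_run p e x s = Suc y"
  using run_reaches[OF assms, of 0] unfolding reaches_def bounded_run_eq_Suc .

text \<open>Where the program has a value, correctness of an early result follows from determinism: the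
  machine reaches the right value at some time, and results never change. This spares a separate analysis
  of halting runs.\<close>

lemma bounded_run_sound:
  assumes "run (prog e) p x = Some y" and "bounded_run p e x s \<noteq> 0"
  shows "bounded_run p e x s = Suc y"
proof -
  obtain s' where s': "bounded_run p e x s' = Suc y"
    using bounded_run_halts[OF assms(1)] ..
  obtain z where z: "bounded_run p e x s = Suc z"
    using assms(2) not0_implies_Suc by blast
  show ?thesis
    using bounded_run_mono[OF s', of "max s s'"] bounded_run_mono[OF z, of "max s s'"] z by simp
qed

lemma total_rec_bounded_run [total_rec_intros]:
  assumes "total_rec (\<lambda>p z. q p (pfst z) (psnd z))"
    and "total_rec e" and "total_rec x" and "total_rec s"
  shows "total_rec (\<lambda>p z. bounded_run (q p z) (e p z) (x p z) (s p z))"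
proof -
  have "total_rec (\<lambda>p z. step (q p (pfst z)) (psnd z))"
    unfolding step_def resume_def start_def Let_def frame_def eval_state_def return_state_def
    by (intro total_rec_intros total_rec_comp2[OF assms(1)])
  then show ?thesis
    using assms(2-) unfolding bounded_run_def Let_def eval_state_def
    by (intro total_rec_intros)
qed


section \<open>Increasing sequences of zeros\<close>

definition zeros_below :: "baire \<Rightarrow> nat \<Rightarrow> nat" where
  "zeros_below v y = rec_nat 0 (\<lambda>k c. if v k = 0 then Suc c else c) y"

lemma zeros_below_simps [simp]:
  "zeros_below v 0 = 0"
  "zeros_below v (Suc y) = (if v y = 0 then Suc (zeros_below v y) else zeros_below v y)"
  by (simp_all add: zeros_below_def)

lemma zeros_below_mono: "y \<le> z \<Longrightarrow> zeros_below v y \<le> zeros_below v z"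
  by (rule lift_Suc_mono_le[of "zeros_below v"]) auto

lemma zeros_below_eq:
  assumes "a \<le> b" and "\<And>j. a \<le> j \<Longrightarrow> j < b \<Longrightarrow> v j \<noteq> 0"
  shows "zeros_below v b = zeros_below v a"
  using assms by (induction b rule: dec_induct) auto

text \<open>A solution may skip zeros, so only an inequality holds.\<close>

lemma W_le_zeros_below:
  assumes "w \<in> W v"
  shows "k \<le> zeros_below v (w k)"
proof (induction k)
  case (Suc k)
  have "v (w k) = 0" and "w k < w (Suc k)"
    using assms by (auto simp: W_def fun_eq_iff)
  then have "zeros_below v (w k) < zeros_below v (w (Suc k))"
    using zeros_below_mono[of "Suc (w k)" "w (Suc k)" v] by simp
  then show ?case
    using Suc by simp
qed simp

lemma W_unbounded:
  assumes "w \<in> W v"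
  shows "\<exists>y\<ge>n. v y = 0"
proof -
  have "n \<le> w n"
    using assms by (intro strict_mono_imp_increasing) (auto simp: W_def strict_mono_Suc_iff)
  moreover have "v (w n) = 0"
    using assms by (auto simp: W_def fun_eq_iff)
  ultimately show ?thesis by blast
qed

text \<open>From any position, the next zero has as many zeros below it as that position.\<close>

lemma zero_of_rank:
  assumes unbounded: "\<And>n. \<exists>y\<ge>n. v y = 0"
  shows "\<exists>y. v y = 0 \<and> zeros_below v y = k"
proof -
  have gap: "\<exists>y\<ge>a. v y = 0 \<and> zeros_below v y = zeros_below v a" for a
  proof -
    let ?y = "LEAST y. a \<le> y \<and> v y = 0"
    have y: "a \<le> ?y" "v ?y = 0"
      using LeastI_ex[of "\<lambda>y. a \<le> y \<and> v y = 0"] unbounded[of a] by auto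
    moreover have "zeros_below v ?y = zeros_below v a"
      using y(1) not_less_Least[of _ "\<lambda>y. a \<le> y \<and> v y = 0"] by (intro zeros_below_eq) auto
    ultimately show ?thesis by blast
  qed
  show ?thesis
  proof (induction k)
    case 0
    then show ?case using gap[of 0] by auto
  next
    case (Suc k)
    then obtain y where "v y = 0" "zeros_below v y = k" by blast
    then show ?case using gap[of "Suc y"] by auto
  qed
qed

text \<open>Determining the \<open>k\<close>-th zero by its rank, rather than as the successor of the zero
  before it, makes each term the result of a single search.\<close>

lemma least_zero_of_rank_in_W:
  assumes "\<And>n. \<exists>y\<ge>n. v y = 0"
  shows "(\<lambda>k. LEAST y. v y = 0 \<and> zeros_below v y = k) \<in> W v"
proof -
  let ?w = "\<lambda>k. LEAST y. v y = 0 \<and> zeros_below v y = k"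
  have w: "v (?w k) = 0" "zeros_below v (?w k) = k" for k
    using LeastI_ex[OF zero_of_rank[OF assms, of k]] by auto
  have "?w k < ?w (Suc k)" for k
    using zeros_below_mono[of "?w (Suc k)" "?w k" v] w(2) by (metis Suc_n_not_le_n not_le)
  then show ?thesis
    using w(1) by (auto simp: W_def)
qed


section \<open>Solving choice and zero search in parallel by the jump\<close>

lemma Phi_run:
  assumes "Phi e p = Some x"
  shows "run (prog e) p n = Some (x n)"
  using assms by (auto simp: Phi_def functional_def split: if_splits)

lemma tot_jump_nonempty: "tot_jump f r \<noteq> {}"
  by (auto simp: tot_jump_def tot_jump_at_def pdom_def)

text \<open>For \<open>R = bpair r q\<close>, the values \<open>y\<close> that may stand at position \<open>n\<close>
  of the pair of \<open>q\<close> and the enumeration of the zeros of \<open>bsnd r\<close>; one search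
  serves both halves.\<close>

definition solve_pair :: "baire \<Rightarrow> nat \<Rightarrow> nat \<Rightarrow> bool" where
  "solve_pair R n y \<longleftrightarrow>
     (even n \<and> y = bsnd R (n div 2)) \<or>
     (odd n \<and> bsnd (bfst R) y = 0 \<and> zeros_below (bsnd (bfst R)) y = n div 2)"

lemma partial_computable_solve_pair:
  "partial_computable
    (\<lambda>R. if \<forall>n. \<exists>y. solve_pair R n y then Some (\<lambda>n. LEAST y. solve_pair R n y) else None)"
  unfolding solve_pair_def bsnd_def bfst_def zeros_below_def
  by (intro partial_computable_search total_rec_intros)

lemma solve_pair_correct:
  assumes "bsnd r \<in> pdom W"
  shows "\<forall>n. \<exists>y. solve_pair (bpair r q) n y"
    and "\<exists>w\<in>W (bsnd r). (\<lambda>n. LEAST y. solve_pair (bpair r q) n y) = bpair q w"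
proof -
  have unbounded: "\<exists>y\<ge>n. bsnd r y = 0" for n
    using assms W_unbounded unfolding pdom_def by blast
  show "\<forall>n. \<exists>y. solve_pair (bpair r q) n y"
    using zero_of_rank[OF unbounded] by (auto simp: solve_pair_def)
  let ?w = "\<lambda>k. LEAST y. bsnd r y = 0 \<and> zeros_below (bsnd r) y = k"
  have "(\<lambda>n. LEAST y. solve_pair (bpair r q) n y) = bpair q ?w"
    by (auto simp: solve_pair_def bpair_def[of q] fun_eq_iff intro: Least_equality)
  then show "\<exists>w\<in>W (bsnd r). (\<lambda>n. LEAST y. solve_pair (bpair r q) n y) = bpair q w"
    using least_zero_of_rank_in_W[OF unbounded] by blast
qed

text \<open>The answer of the jump is already a solution, so the outer functional only forgets the
  input, and it is total as required for instances without a solution.\<close>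

lemma parallel_choice_le_tot_jump: "totalization (C\<^sub>\<nat> \<times>\<^sub>p W) \<le>\<^sub>W tot_jump C\<^sub>\<nat>"
proof -
  have "partial_computable (\<lambda>r. Some (bfst r))"
    by (rule partial_computable_total) (unfold bfst_def, intro total_rec_intros)
  then obtain e where e: "Phi e = (\<lambda>r. Some (bfst r))"
    unfolding partial_computable_iff_Phi by metis
  obtain i where i: "Phi i =
      (\<lambda>R. if \<forall>n. \<exists>y. solve_pair R n y then Some (\<lambda>n. LEAST y. solve_pair R n y) else None)"
    using partial_computable_solve_pair unfolding partial_computable_iff_Phi by metis
  let ?F = "\<lambda>r n. if n = 0 then e else if n = 1 then i else r (n - 2)"
  have F: "partial_computable (\<lambda>r. Some (?F r))"
    by (rule partial_computable_total) (intro total_rec_intros)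
  have G: "partial_computable (\<lambda>R. Some (bsnd R))"
    by (rule partial_computable_total) (unfold bsnd_def, intro total_rec_intros)
  have solves: "q \<in> totalization (C\<^sub>\<nat> \<times>\<^sub>p W) r" if q: "q \<in> tot_jump C\<^sub>\<nat> (?F r)" for q r
  proof (cases "r \<in> pdom (C\<^sub>\<nat> \<times>\<^sub>p W)")
    case True
    then have choice: "bfst r \<in> pdom C\<^sub>\<nat>" and zeros: "bsnd r \<in> pdom W"
      by (auto simp: pdom_def parallel_product_def)
    have "tot_jump C\<^sub>\<nat> (?F r) = {the (Phi i (bpair r a)) | a. a \<in> C\<^sub>\<nat> (bfst r)}"
      using choice solve_pair_correct(1)[OF zeros]
      by (simp add: tot_jump_def tot_jump_at_def e i)
    then obtain a where a: "a \<in> C\<^sub>\<nat> (bfst r)" and "q = the (Phi i (bpair r a))"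
      using q by auto
    then have "q = (\<lambda>n. LEAST y. solve_pair (bpair r a) n y)"
      using solve_pair_correct(1)[OF zeros] by (simp add: i)
    then obtain w where "w \<in> W (bsnd r)" "q = bpair a w"
      using solve_pair_correct(2)[OF zeros] by metis
    then show ?thesis
      using a True by (auto simp: totalization_def parallel_product_def)
  qed (simp add: totalization_def)
  show ?thesis
    unfolding weihrauch_le_def
    using F G solves tot_jump_nonempty
    by (intro exI[of _ "\<lambda>r. Some (?F r)"] exI[of _ "\<lambda>R. Some (bsnd R)"]) (auto simp: pdom_def)
qed


section \<open>Solving the jump by choice and zero search\<close>

definition tail2 :: "baire \<Rightarrow> baire" where
  "tail2 r = (\<lambda>n. r (n + 2))"

lemma tot_jump_tail2: "tot_jump f r = tot_jump_at f (r 0) (r 1) (tail2 r)"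
  by (simp add: tot_jump_def tail2_def)

text \<open>Subtracting one reads the result of a halted run; for a run that has not halted it gives
  \<open>0\<close>, a value whose occurrence excludes no choice.\<close>

definition choice_query :: "baire \<Rightarrow> baire" where
  "choice_query r s = bounded_run (tail2 r) (r 0) (pfst s) (psnd s) - 1"

text \<open>The number \<open>n\<close> is represented by the sequence \<open>n, 0, 0, \<dots>\<close>. Any
  representative gives an admissible output of the jump, so one that is computable from \<open>n\<close>
  suffices.\<close>

definition answer :: "baire \<Rightarrow> nat \<Rightarrow> nat \<Rightarrow> nat \<Rightarrow> nat" where
  "answer r n k s = bounded_run (bpair (tail2 r) (\<lambda>m. if m = 0 then n else 0)) (r 1) k s"

text \<open>By stage \<open>s\<close>, every \<open>n \<le> k\<close> is excluded as a choice or has its output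
  computed up to digit \<open>k\<close>.\<close>

definition ready :: "baire \<Rightarrow> nat \<Rightarrow> nat \<Rightarrow> bool" where
  "ready r k s \<longleftrightarrow>
     (\<forall>n\<le>k. (\<exists>m\<le>s. choice_query r m = Suc n) \<or> (\<forall>j\<le>k. answer r n j s \<noteq> 0))"

text \<open>The number of zeros placed before stage \<open>s\<close>, defined ahead of the sequence that they
  belong to in order to avoid course-of-values recursion; \<open>zeros_below_search_query\<close> states
  the agreement.\<close>

definition ready_count :: "baire \<Rightarrow> nat \<Rightarrow> nat" where
  "ready_count r s = rec_nat 0 (\<lambda>t c. if ready r c t then Suc c else c) s"

definition search_query :: "baire \<Rightarrow> baire" where
  "search_query r s = (if ready r (ready_count r s) s then 0 else 1)"

text \<open>For \<open>R = bpair r (bpair a w)\<close>, digit \<open>k\<close> of the output for the choice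
  \<open>n = a 0\<close>, with \<open>w (max k n)\<close> as the time bound. The maximum makes the zero late
  enough for the waiting condition at rank \<open>k\<close> to speak of \<open>n\<close> as well as of digit
  \<open>k\<close>.\<close>

definition digit :: "baire \<Rightarrow> baire" where
  "digit R k =
     (let n = bsnd R 0 in answer (bfst R) n k (bsnd (bsnd R) (max k n)) - 1)"

lemma total_rec_choice_query: "total_rec a \<Longrightarrow> total_rec (\<lambda>r x. choice_query r (a r x))"
  unfolding choice_query_def tail2_def by (intro total_rec_intros)

lemma total_rec_answer:
  assumes "total_rec n" and "total_rec k" and "total_rec s"
  shows "total_rec (\<lambda>r x. answer r (n r x) (k r x) (s r x))"
  unfolding answer_def tail2_def bpair_def
  by (intro total_rec_intros total_rec_comp[OF assms(1)] assms(2,3))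

lemma decidable_ready:
  assumes "total_rec k" and "total_rec s"
  shows "decidable (\<lambda>r x. ready r (k r x) (s r x))"
  unfolding ready_def
  by (intro total_rec_intros total_rec_choice_query total_rec_answer
      total_rec_comp[OF assms(1)] total_rec_comp[OF assms(2)])

lemma total_rec_ready_count: "total_rec s \<Longrightarrow> total_rec (\<lambda>r x. ready_count r (s r x))"
  unfolding ready_count_def by (intro total_rec_intros decidable_ready)

lemma total_rec_search_query: "total_rec s \<Longrightarrow> total_rec (\<lambda>r x. search_query r (s r x))"
  unfolding search_query_def
  by (intro total_rec_intros decidable_ready total_rec_ready_count)

lemma total_rec_digit: "total_rec digit"
proof -
  have "total_rec (\<lambda>R k. digit R k)"
    unfolding digit_def Let_def answer_def tail2_def bpair_def bfst_def bsnd_def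
    by (intro total_rec_intros)
  then show ?thesis .
qed

lemma zeros_below_search_query: "zeros_below (search_query r) s = ready_count r s"
  by (induction s) (simp_all add: ready_count_def search_query_def)

lemma choice_query_correct:
  assumes "Phi (r 0) (tail2 r) = Some x"
  shows "Suc n \<in> range (choice_query r) \<longleftrightarrow> Suc n \<in> range x"
proof
  assume "Suc n \<in> range (choice_query r)"
  then obtain s where s: "choice_query r s = Suc n" by (metis rangeE)
  then have "bounded_run (tail2 r) (r 0) (pfst s) (psnd s) = Suc (x (pfst s))"
    by (intro bounded_run_sound Phi_run[OF assms]) (auto simp: choice_query_def)
  then have "x (pfst s) = Suc n"
    using s by (simp add: choice_query_def)
  then show "Suc n \<in> range x" by (metis rangeI)
next
  assume "Suc n \<in> range x"
  then obtain m where m: "x m = Suc n" by (metis rangeE)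
  obtain t where "bounded_run (tail2 r) (r 0) m t = Suc (x m)"
    using bounded_run_halts[OF Phi_run[OF assms]] by blast
  then have "choice_query r \<langle>m, t\<rangle> = Suc n"
    using m by (simp add: choice_query_def)
  then show "Suc n \<in> range (choice_query r)" by (metis rangeI)
qed

text \<open>Each of the finitely many waits ends and stays ended, because the machine's results persist;
  a sum of the individual bounds is a common bound.\<close>

lemma eventually_ready:
  assumes "\<And>n j. Suc n \<notin> range (choice_query r) \<Longrightarrow> \<exists>s. answer r n j s \<noteq> 0"
  shows "\<exists>s0. \<forall>s\<ge>s0. ready r k s"
proof -
  have "\<exists>s0. \<forall>s\<ge>s0. (\<exists>m\<le>s. choice_query r m = Suc n) \<or> answer r n j s \<noteq> 0" for n j
  proof (cases "Suc n \<in> range (choice_query r)")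
    case True
    then obtain m where "choice_query r m = Suc n" by (metis rangeE)
    then show ?thesis by blast
  next
    case False
    then obtain s0 y where "answer r n j s0 = Suc y"
      using assms not0_implies_Suc by blast
    then have "answer r n j s \<noteq> 0" if "s0 \<le> s" for s
      using bounded_run_mono[OF _ that] unfolding answer_def by simp
    then show ?thesis by blast
  qed
  then obtain b where b: "(\<exists>m\<le>s. choice_query r m = Suc n) \<or> answer r n j s \<noteq> 0"
    if "b n j \<le> s" for n j s
    by metis
  define B where "B = (\<Sum>n\<le>k. \<Sum>j\<le>k. b n j)"
  have "b n j \<le> B" if "n \<le> k" "j \<le> k" for n j
  proof -
    have "b n j \<le> (\<Sum>j\<le>k. b n j)"
      using that by (intro member_le_sum) auto
    also have "\<dots> \<le> B"
      unfolding B_def using that by (intro member_le_sum) auto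
    finally show ?thesis .
  qed
  then have "\<forall>s\<ge>B. ready r k s"
    unfolding ready_def using b le_trans by meson
  then show ?thesis ..
qed

text \<open>After a last zero the rank would remain constant, and the waiting condition for this fixed rank
  would eventually hold and produce another zero.\<close>

lemma search_query_in_pdom_W:
  assumes "\<And>k. \<exists>s0. \<forall>s\<ge>s0. ready r k s"
  shows "search_query r \<in> pdom W"
proof -
  have "\<exists>s\<ge>n. search_query r s = 0" for n
  proof (rule ccontr)
    assume no: "\<not> (\<exists>s\<ge>n. search_query r s = 0)"
    obtain s0 where s0: "\<And>s. s0 \<le> s \<Longrightarrow> ready r (ready_count r n) s"
      using assms by blast
    let ?s = "max n s0"
    have "ready_count r ?s = ready_count r n"
      unfolding zeros_below_search_query[symmetric] using no by (intro zeros_below_eq) auto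
    then have "search_query r ?s = 0"
      using s0[of ?s] by (simp add: search_query_def)
    then show False
      using no by (meson max.cobounded1)
  qed
  then show ?thesis
    using least_zero_of_rank_in_W unfolding pdom_def by blast
qed

text \<open>The point of the construction: although the search query treats all choices alike, its zeros
  bound the computation time for whichever unlisted \<open>n\<close> is chosen.\<close>

lemma answer_at_zero:
  assumes "Suc n \<notin> range (choice_query r)" and "w \<in> W (search_query r)"
  shows "answer r n k (w (max k n)) \<noteq> 0"
proof -
  let ?s = "w (max k n)"
  have "search_query r ?s = 0"
    using assms(2) by (auto simp: W_def fun_eq_iff)
  then have "ready r (ready_count r ?s) ?s"
    by (simp add: search_query_def split: if_splits)
  moreover have "max k n \<le> ready_count r ?s"
    using W_le_zeros_below[OF assms(2)] unfolding zeros_below_search_query .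
  moreover have "choice_query r m \<noteq> Suc n" for m
    using assms(1) by (metis rangeI)
  ultimately show ?thesis
    unfolding ready_def by (meson max.bounded_iff)
qed

lemma tot_jump_le_parallel_choice: "tot_jump C\<^sub>\<nat> \<le>\<^sub>W totalization (C\<^sub>\<nat> \<times>\<^sub>p W)"
proof -
  let ?F = "\<lambda>r. bpair (choice_query r) (search_query r)"
  have F: "partial_computable (\<lambda>r. Some (?F r))"
    by (rule partial_computable_total)
      (unfold bpair_def, intro total_rec_intros total_rec_choice_query total_rec_search_query)
  have G: "partial_computable (\<lambda>R. Some (digit R))"
    using total_rec_digit by (rule partial_computable_total)
  have solves: "digit (bpair r q) \<in> tot_jump C\<^sub>\<nat> r"
    if q: "q \<in> totalization (C\<^sub>\<nat> \<times>\<^sub>p W) (?F r)" for q r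
  proof (cases "\<exists>x. Phi (r 0) (tail2 r) = Some x \<and> x \<in> pdom C\<^sub>\<nat> \<and>
      (\<forall>q\<in>C\<^sub>\<nat> x. Phi (r 1) (bpair (tail2 r) q) \<noteq> None)")
    case False
    then have "tot_jump C\<^sub>\<nat> r = UNIV"
      unfolding tot_jump_tail2 tot_jump_at_def by (rule if_not_P)
    then show ?thesis by simp
  next
    case True
    then obtain x where x: "Phi (r 0) (tail2 r) = Some x" and dom: "x \<in> pdom C\<^sub>\<nat>"
      and def: "\<And>q. q \<in> C\<^sub>\<nat> x \<Longrightarrow> Phi (r 1) (bpair (tail2 r) q) \<noteq> None"
      by blast
    \<comment> \<open>The meaningful case: the jump consists of the outputs for the choices from \<open>x\<close>.\<close>
    have jump: "tot_jump C\<^sub>\<nat> r = {the (Phi (r 1) (bpair (tail2 r) q)) | q. q \<in> C\<^sub>\<nat> x}"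
      using dom def unfolding tot_jump_tail2 tot_jump_at_def x by simp
    have choice: "C\<^sub>\<nat> (choice_query r) = C\<^sub>\<nat> x"
      using choice_query_correct[of r x, OF x] by (simp add: choice_nat_def)
    let ?c = "\<lambda>n m. if m = 0 then n else 0"
    have unlisted: "?c n \<in> C\<^sub>\<nat> x" if "Suc n \<notin> range (choice_query r)" for n
      unfolding choice[symmetric] using that by (simp add: choice_nat_def)
    have "\<exists>s. answer r n j s \<noteq> 0" if n: "Suc n \<notin> range (choice_query r)" for n j
    proof -
      obtain y where "Phi (r 1) (bpair (tail2 r) (?c n)) = Some y"
        using def[OF unlisted[OF n]] by blast
      from bounded_run_halts[OF Phi_run[OF this]] show ?thesis
        unfolding answer_def by (metis nat.distinct(1))
    qed
    then have "search_query r \<in> pdom W"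
      by (intro search_query_in_pdom_W eventually_ready)
    then have "?F r \<in> pdom (C\<^sub>\<nat> \<times>\<^sub>p W)"
      using dom choice by (auto simp: pdom_def parallel_product_def)
    then obtain a w where q_eq: "q = bpair a w" and a: "a \<in> C\<^sub>\<nat> (choice_query r)"
      and w: "w \<in> W (search_query r)"
      using q by (auto simp: totalization_def parallel_product_def)
    define n where "n = a 0"
    have n: "Suc n \<notin> range (choice_query r)"
      using a by (simp add: choice_nat_def n_def)
    obtain y where y: "Phi (r 1) (bpair (tail2 r) (?c n)) = Some y"
      using def[OF unlisted[OF n]] by blast
    have "answer r n k (w (max k n)) = Suc (y k)" for k
      using answer_at_zero[OF n w, of k] bounded_run_sound[OF Phi_run[OF y]]
      unfolding answer_def by blast
    moreover have "bsnd (bpair r q) 0 = n"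
      unfolding bpair_simps by (simp add: q_eq n_def bpair_def)
    ultimately have "digit (bpair r q) = y"
      by (simp add: digit_def Let_def q_eq fun_eq_iff)
    then show ?thesis
      unfolding jump using y unlisted[OF n] by force
  qed
  show ?thesis
    unfolding weihrauch_le_def
    using F G solves
    by (intro exI[of _ "\<lambda>r. Some (?F r)"] exI[of _ "\<lambda>R. Some (digit R)"])
      (auto simp: pdom_def totalization_def)
qed

theorem theorem4p15: "tot_jump C\<^sub>\<nat> \<equiv>\<^sub>W totalization (C\<^sub>\<nat> \<times>\<^sub>p W)"
  unfolding weihrauch_equiv_def
  using tot_jump_le_parallel_choice parallel_choice_le_tot_jump by blast

end
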